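(* Assume the Axiom of Choice. A non-spatial MT-algebra does not admit a $T_1$-compactification; that is, if $M$ is an MT-algebra that is not spatial, then there is no pair $(N,h)$ consisting of a compact $T_1$ MT-algebra $N$ and a dense MT-embedding $h:N\to M$.
   Context: An MT-algebra is a pair $(M,\square)$, where $M$ is a complete Boolean algebra and $\square:M\to M$ satisfies $\square 1=1$, $\square(a\wedge b)=\square a\wedge\square b$, $\square a\le a$, $\square a\le\square\square a$. Put $\Diamond a=\neg\square\neg a$. An element $a$ is open if $a=\square a$ and closed if $a=\Diamond a$; $\mathcal O(M)$ and $\mathcal C(M)$ are the sets of open and closed elements. An MT-morphism $h:N\to M$ is a complete Boolean homomorphism with $h(\square a)\le\square h(a)$ for all $a$; it restricts to a frame homomorphism $\mathcal O(h):\mathcal O(N)\to\mathcal O(M)$. $M$ is spatial if it is atomic as a Boolean algebra. $M$ is $T_1$ if every element is a join of closed elements. $M$ is compact if whenever $\bigvee S=1$ with $S\subseteq\mathcal O(M)$, there is a finite $T\subseteq S$ with $\bigvee T=1$. An MT-morphism $h:N\to M$ is dense if $h(u)=0$ implies $u=0$ for every $u\in\mathcal O(N)$, and is an MT-embedding if both $h$ and $\mathcal O(h)$ are onto. A compactification of $M$ is a pair $(N,h)$ with $N$ a compact MT-algebra and $h:N\to M$ a dense MT-embedding; it is a $T_1$-compactification if $N$ is $T_1$. *)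

theory Defs
  imports Main
begin

text \<open>
  The carrier of an MT-algebra is a whole type of sort \<open>{boolean_algebra, complete_lattice}\<close>, that
  is, a complete Boolean algebra. The library class \<open>complete_boolean_algebra\<close> must not be used
  here: it extends \<open>complete_distrib_lattice\<close>, which demands complete distributivity, so all its
  instances are atomic. The operator \<open>\<box>\<close> is an explicit parameter, so one type can carry several
  MT-algebra structures.
\<close>

locale mt_algebra =
  fixes box :: "'a::{boolean_algebra, complete_lattice} \<Rightarrow> 'a"
  assumes box_top: "box top = top"
    and box_inf: "box (inf a b) = inf (box a) (box b)"
    and box_le: "box a \<le> a"
    and box_le_box_box: "box a \<le> box (box a)"

definition mt_diamond :: "('a::{boolean_algebra, complete_lattice} \<Rightarrow> 'a) \<Rightarrow> 'a \<Rightarrow> 'a" where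
  "mt_diamond box a = - box (- a)"

definition mt_opens :: "('a::{boolean_algebra, complete_lattice} \<Rightarrow> 'a) \<Rightarrow> 'a set" where
  "mt_opens box = {a. a = box a}"

definition mt_closeds :: "('a::{boolean_algebra, complete_lattice} \<Rightarrow> 'a) \<Rightarrow> 'a set" where
  "mt_closeds box = {a. a = mt_diamond box a}"

definition ba_atom :: "'a::boolean_algebra \<Rightarrow> bool" where
  "ba_atom x \<longleftrightarrow> x \<noteq> bot \<and> (\<forall>b. b < x \<longrightarrow> b = bot)"

text \<open>
  Spatiality depends only on the underlying Boolean algebra; \<open>box\<close> occurs as an argument merely so
  that the predicate can be applied to an MT-algebra.
\<close>

definition mt_spatial :: "('a::{boolean_algebra, complete_lattice} \<Rightarrow> 'a) \<Rightarrow> bool" where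
  "mt_spatial box \<longleftrightarrow> (\<forall>a::'a. a \<noteq> bot \<longrightarrow> (\<exists>x. ba_atom x \<and> x \<le> a))"

definition mt_T1 :: "('a::{boolean_algebra, complete_lattice} \<Rightarrow> 'a) \<Rightarrow> bool" where
  "mt_T1 box \<longleftrightarrow> (\<forall>a. \<exists>S \<subseteq> mt_closeds box. a = Sup S)"

definition mt_compact :: "('a::{boolean_algebra, complete_lattice} \<Rightarrow> 'a) \<Rightarrow> bool" where
  "mt_compact box \<longleftrightarrow>
     (\<forall>S \<subseteq> mt_opens box. Sup S = top \<longrightarrow> (\<exists>T \<subseteq> S. finite T \<and> Sup T = top))"

text \<open>
  \<open>S\<close> ranges over all subsets, so preservation of \<open>bot\<close>, \<open>top\<close>, \<open>sup\<close> and \<open>inf\<close> is included.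
\<close>

definition complete_boolean_hom ::
  "('b::{boolean_algebra, complete_lattice} \<Rightarrow> 'a::{boolean_algebra, complete_lattice}) \<Rightarrow> bool" where
  "complete_boolean_hom h \<longleftrightarrow>
     (\<forall>S. h (Sup S) = Sup (h ` S)) \<and> (\<forall>S. h (Inf S) = Inf (h ` S)) \<and> (\<forall>a. h (- a) = - h a)"

definition mt_morphism ::
  "('b::{boolean_algebra, complete_lattice} \<Rightarrow> 'b) \<Rightarrow> ('a::{boolean_algebra, complete_lattice} \<Rightarrow> 'a)
    \<Rightarrow> ('b \<Rightarrow> 'a) \<Rightarrow> bool" where
  "mt_morphism boxN boxM h \<longleftrightarrow>
     complete_boolean_hom h \<and> (\<forall>a. h (boxN a) \<le> boxM (h a))"

definition mt_dense ::
  "('b::{boolean_algebra, complete_lattice} \<Rightarrow> 'b) \<Rightarrow> ('b \<Rightarrow> 'a::{boolean_algebra, complete_lattice})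
    \<Rightarrow> bool" where
  "mt_dense boxN h \<longleftrightarrow> (\<forall>u \<in> mt_opens boxN. h u = bot \<longrightarrow> u = bot)"

definition mt_embedding ::
  "('b::{boolean_algebra, complete_lattice} \<Rightarrow> 'b) \<Rightarrow> ('a::{boolean_algebra, complete_lattice} \<Rightarrow> 'a)
    \<Rightarrow> ('b \<Rightarrow> 'a) \<Rightarrow> bool" where
  "mt_embedding boxN boxM h \<longleftrightarrow>
     mt_morphism boxN boxM h \<and> surj h \<and> h ` mt_opens boxN = mt_opens boxM"

definition mt_compactification ::
  "('a::{boolean_algebra, complete_lattice} \<Rightarrow> 'a) \<Rightarrow> ('b::{boolean_algebra, complete_lattice} \<Rightarrow> 'b)
    \<Rightarrow> ('b \<Rightarrow> 'a) \<Rightarrow> bool" where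
  "mt_compactification boxM boxN h \<longleftrightarrow>
     mt_algebra boxN \<and> mt_compact boxN \<and> mt_embedding boxN boxM h \<and> mt_dense boxN h"

definition mt_T1_compactification ::
  "('a::{boolean_algebra, complete_lattice} \<Rightarrow> 'a) \<Rightarrow> ('b::{boolean_algebra, complete_lattice} \<Rightarrow> 'b)
    \<Rightarrow> ('b \<Rightarrow> 'a) \<Rightarrow> bool" where
  "mt_T1_compactification boxM boxN h \<longleftrightarrow> mt_compactification boxM boxN h \<and> mt_T1 boxN"

end

theory Submission
  imports Defs
begin

text \<open>
  A compact \<open>T\<^sub>1\<close> MT-algebra is spatial: by compactness and Zorn's lemma, below every nonzero closed
  element lies a minimal nonzero closed one, and since all elements are joins of closed ones, such
  an element is an atom. An onto complete Boolean homomorphism is, up to isomorphism, the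
  relativization to the complement of its largest kernel element, so spatiality passes to its
  image.
\<close>

text \<open>Complementation is an order-reversing involution, so it exchanges infima and suprema.
  This translates between families of closed elements and families of open ones.\<close>

lemma complete_ba_compl_Inf:
  fixes C :: "'a::{boolean_algebra, complete_lattice} set"
  shows "- Inf C = Sup (uminus ` C)"
proof (rule order.antisym)
  have "- Sup (uminus ` C) \<le> c" if "c \<in> C" for c
    by (rule compl_le_swap2) (simp add: Sup_upper that)
  then have "- Sup (uminus ` C) \<le> Inf C"
    by (rule Inf_greatest)
  then show "- Inf C \<le> Sup (uminus ` C)"
    by (rule compl_le_swap2)
  show "Sup (uminus ` C) \<le> - Inf C"
    by (rule Sup_least) (auto intro: Inf_lower)
qed

context mt_algebra
begin

lemma box_mono: "a \<le> b \<Longrightarrow> box a \<le> box b"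
  by (metis box_inf inf.absorb_iff1)

lemma mt_closeds_iff: "c \<in> mt_closeds box \<longleftrightarrow> - c \<in> mt_opens box"
  unfolding mt_closeds_def mt_opens_def mt_diamond_def
  by (metis (mono_tags) boolean_algebra_class.boolean_algebra.double_compl mem_Collect_eq)

lemma Sup_mt_opens:
  assumes "U \<subseteq> mt_opens box"
  shows "Sup U \<in> mt_opens box"
proof -
  have "Sup U \<le> box (Sup U)"
  proof (rule Sup_least)
    fix u assume "u \<in> U"
    then have "box u = u"
      using assms by (metis (mono_tags) mem_Collect_eq mt_opens_def subsetD)
    then show "u \<le> box (Sup U)"
      using box_mono[OF Sup_upper[OF \<open>u \<in> U\<close>]] by argo
  qed
  then show ?thesis
    unfolding mt_opens_def by (intro CollectI order.antisym box_le)
qed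

lemma Inf_mt_closeds: "C \<subseteq> mt_closeds box \<Longrightarrow> Inf C \<in> mt_closeds box"
  unfolding mt_closeds_iff complete_ba_compl_Inf
  by (rule Sup_mt_opens) (auto simp: mt_closeds_iff)

text \<open>The finite intersection property for chains: if the infimum were \<open>bot\<close>, the
  complements would form an open cover, and a finite subcover would give a finite part of the chain
  with infimum \<open>bot\<close>. A member of the chain lies below that part, so it would be
  \<open>bot\<close>.\<close>

lemma mt_compact_Inf_chain_nonzero:
  assumes compact: "mt_compact box"
    and closed: "C \<subseteq> mt_closeds box"
    and nonzero: "bot \<notin> C"
    and nonempty: "C \<noteq> {}"
    and chain: "\<And>a b. a \<in> C \<Longrightarrow> b \<in> C \<Longrightarrow> a \<le> b \<or> b \<le> a"
  shows "Inf C \<noteq> bot"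
proof
  assume "Inf C = bot"
  then have cover: "Sup (uminus ` C) = top"
    by (simp flip: complete_ba_compl_Inf)
  have "uminus ` C \<subseteq> mt_opens box"
    using closed by (auto simp: mt_closeds_iff)
  then obtain T where T: "T \<subseteq> uminus ` C" "finite T" "Sup T = top"
    using compact[unfolded mt_compact_def, rule_format, OF _ cover] by iprover
  obtain F where F: "F \<subseteq> C" "finite F" "T = uminus ` F"
    using T(1,2) by (meson finite_subset_image)
  \<comment> \<open>The bound is sought in \<open>C\<close>, not in \<open>F\<close>, so that an
    empty \<open>F\<close> is covered as well, by \<open>nonempty\<close>.\<close>
  have "\<exists>m\<in>C. \<forall>x\<in>F. m \<le> x"
    using F(2,1)
  proof (induction F rule: finite_induct)
    case empty
    then show ?case using nonempty by auto
  next
    case (insert x F)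
    then obtain m where m: "m \<in> C" "\<forall>y\<in>F. m \<le> y" by auto
    have "x \<in> C" using insert.prems by simp
    then have "m \<le> x \<or> x \<le> m" using chain m(1) by blast
    then show ?case
      using m \<open>x \<in> C\<close> by (metis insertE order.refl order.trans)
  qed
  then obtain m where m: "m \<in> C" "\<forall>x\<in>F. m \<le> x" by blast
  have "- Inf F = top" using T(3) F(3) by (simp add: complete_ba_compl_Inf)
  then have "Inf F = bot"
    by (metis boolean_algebra_class.boolean_algebra.double_compl compl_top_eq)
  moreover have "m \<le> Inf F" using m(2) by (simp add: Inf_greatest)
  ultimately have "m = bot" by (simp add: bot_unique)
  then show False using m(1) nonzero by simp
qed

lemma mt_compact_minimal_closed:
  assumes compact: "mt_compact box"
    and c: "c \<in> mt_closeds box" "c \<noteq> bot"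
  obtains m where "m \<in> mt_closeds box" "m \<noteq> bot" "m \<le> c"
    "\<And>d. d \<in> mt_closeds box \<Longrightarrow> d \<noteq> bot \<Longrightarrow> d \<le> m \<Longrightarrow> d = m"
proof -
  define A where "A = {d \<in> mt_closeds box. d \<noteq> bot \<and> d \<le> c}"
  have "\<exists>m\<in>A. \<forall>a\<in>A. m \<ge> a \<longrightarrow> a = m"
  \<comment> \<open>Zorn's lemma yields maximal elements. For the reversed order
    \<open>(\<ge>)\<close> these are the minimal ones, and the bound of a chain is a lower
    bound.\<close>
  proof (rule predicate_Zorn)
    show "partial_order_on A (relation_of (\<ge>) A)"
      by (rule partial_order_on_relation_ofI) auto
    fix C assume "C \<in> Chains (relation_of (\<ge>) A)"
    then have C: "C \<subseteq> A" "\<And>a b. a \<in> C \<Longrightarrow> b \<in> C \<Longrightarrow> a \<le> b \<or> b \<le> a"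
      by (auto simp: Chains_def relation_of_def)
    show "\<exists>u\<in>A. \<forall>a\<in>C. u \<le> a"
    proof (cases "C = {}")
      case True
      \<comment> \<open>The empty chain is bounded by \<open>c\<close>; its infimum
        \<open>top\<close> need not lie in \<open>A\<close>.\<close>
      then show ?thesis using c by (auto simp: A_def)
    next
      case False
      have "Inf C \<noteq> bot"
        using C False by (intro mt_compact_Inf_chain_nonzero[OF compact]) (auto simp: A_def)
      moreover have "Inf C \<in> mt_closeds box"
        using C(1) by (intro Inf_mt_closeds) (auto simp: A_def)
      moreover have "Inf C \<le> c"
        using C(1) False by (auto simp: A_def intro: Inf_lower2)
      ultimately have "Inf C \<in> A" by (simp add: A_def)
      then show ?thesis by (auto intro: Inf_lower)
    qed
  qed
  then obtain m where "m \<in> A" and min: "\<And>a. a \<in> A \<Longrightarrow> a \<le> m \<Longrightarrow> a = m" by blast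
  show thesis
  proof (rule that)
    show "m \<in> mt_closeds box" "m \<noteq> bot" "m \<le> c"
      using \<open>m \<in> A\<close> by (auto simp: A_def)
    \<comment> \<open>Minimality extends from \<open>A\<close> to all nonzero closed elements, since
      anything below \<open>m\<close> is below \<open>c\<close>.\<close>
    then show "d = m" if "d \<in> mt_closeds box" "d \<noteq> bot" "d \<le> m" for d
      using that by (intro min) (auto simp: A_def)
  qed
qed

lemma mt_T1_closed_below:
  assumes "mt_T1 box" "a \<noteq> bot"
  obtains c where "c \<in> mt_closeds box" "c \<noteq> bot" "c \<le> a"
proof -
  obtain S where S: "S \<subseteq> mt_closeds box" "a = Sup S"
    using assms(1) unfolding mt_T1_def by blast
  moreover obtain c where "c \<in> S" "c \<noteq> bot"
    using S(2) assms(2) by (metis Sup_least bot_unique order.refl)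
  ultimately show thesis
    by (intro that[of c]) (auto intro: Sup_upper)
qed

lemma mt_compact_T1_imp_spatial:
  assumes compact: "mt_compact box" and T1: "mt_T1 box"
  shows "mt_spatial box"
  unfolding mt_spatial_def
proof (intro allI impI)
  fix a :: 'a assume "a \<noteq> bot"
  with T1 obtain c where c: "c \<in> mt_closeds box" "c \<noteq> bot" "c \<le> a"
    by (rule mt_T1_closed_below)
  obtain m where m: "m \<noteq> bot" "m \<le> c"
    and min: "\<And>d. d \<in> mt_closeds box \<Longrightarrow> d \<noteq> bot \<Longrightarrow> d \<le> m \<Longrightarrow> d = m"
    using mt_compact_minimal_closed[OF compact c(1,2)] by blast
  have "b = bot" if "b < m" for b
  proof (rule ccontr)
    assume "b \<noteq> bot"
    \<comment> \<open>Minimality of \<open>m\<close> concerns closed elements only, so the arbitrary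
      \<open>b\<close> is replaced by a closed \<open>d\<close> below it; then
      \<open>m = d \<le> b < m\<close>.\<close>
    with T1 obtain d where d: "d \<in> mt_closeds box" "d \<noteq> bot" "d \<le> b"
      by (rule mt_T1_closed_below)
    then have "d = m" using min that by (meson order.strict_implies_order order.trans)
    then show False using d(3) that by simp
  qed
  then have "ba_atom m" using m(1) by (simp add: ba_atom_def)
  then show "\<exists>x. ba_atom x \<and> x \<le> a"
    using m(2) c(3) by (meson order.trans)
qed

end

lemma complete_boolean_hom_inf:
  assumes "complete_boolean_hom h"
  shows "h (inf a b) = inf (h a) (h b)"
proof -
  have "h (Inf {a, b}) = Inf (h ` {a, b})"
    using assms unfolding complete_boolean_hom_def by blast
  then show ?thesis by simp
qed

lemma complete_boolean_hom_mono:
  "complete_boolean_hom h \<Longrightarrow> a \<le> b \<Longrightarrow> h a \<le> h b"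
  by (metis complete_boolean_hom_inf inf.absorb_iff1)

lemma mt_spatial_image:
  fixes boxN :: "'b::{boolean_algebra, complete_lattice} \<Rightarrow> 'b"
    and boxM :: "'a::{boolean_algebra, complete_lattice} \<Rightarrow> 'a"
    and h :: "'b \<Rightarrow> 'a"
  assumes hom: "complete_boolean_hom h" and surj: "surj h" and spatial: "mt_spatial boxN"
  shows "mt_spatial boxM"
  unfolding mt_spatial_def
proof (intro allI impI)
  fix a :: 'a assume "a \<noteq> bot"
  obtain b where b: "h b = a" using surj by (metis surjD)
  \<comment> \<open>Since \<open>h\<close> preserves arbitrary suprema, \<open>k\<close> is itself
    sent to \<open>bot\<close> and is the largest such element.\<close>
  define k where "k = Sup {x. h x = bot}"
  have "h k = Sup (h ` {x. h x = bot})"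
    using hom unfolding k_def complete_boolean_hom_def by blast
  also have "\<dots> = bot"
    by (rule order.antisym) (auto intro: Sup_least)
  finally have hk: "h k = bot" .
  have "inf b (- k) \<noteq> bot"
  proof
    assume "inf b (- k) = bot"
    then have "b \<le> k" by (simp add: inf_shunt)
    then have "a \<le> bot"
      using complete_boolean_hom_mono[OF hom] b hk by metis
    then show False using \<open>a \<noteq> bot\<close> by (simp add: bot_unique)
  qed
  \<comment> \<open>Lying below \<open>- k\<close> keeps \<open>h x\<close> nonzero; lying below
    \<open>b\<close> puts \<open>h x\<close> below \<open>a\<close>.\<close>
  then obtain x where x: "ba_atom x" "x \<le> inf b (- k)"
    using spatial unfolding mt_spatial_def by blast
  have "h x \<noteq> bot"
  proof
    assume "h x = bot"
    then have "x \<le> k" by (simp add: k_def Sup_upper)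
    then have "x \<le> inf k (- k)"
      using x(2) by (intro inf_greatest) auto
    then show False using x(1) by (simp add: ba_atom_def bot_unique)
  qed
  moreover have "y = bot" if "y < h x" for y
  proof -
    obtain z where z: "h z = y" using surj by (metis surjD)
    \<comment> \<open>Cutting \<open>z\<close> down by \<open>x\<close> gives a preimage of
      \<open>y\<close> below the atom \<open>x\<close>. It is not \<open>x\<close>, as
      \<open>y\<close> differs from \<open>h x\<close>, so it is \<open>bot\<close>.\<close>
    have hz: "h (inf z x) = y"
      using that z by (simp add: complete_boolean_hom_inf[OF hom] inf.absorb1)
    then have "inf z x \<noteq> x" using that by auto
    then have "inf z x < x" by (simp add: order.strict_iff_order)
    then have "inf z x = bot" using x(1) by (simp add: ba_atom_def)
    \<comment> \<open>With \<open>hk\<close> this gives \<open>h bot = bot\<close>, hence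
      \<open>y = bot\<close>.\<close>
    moreover have "h bot \<le> h k" by (rule complete_boolean_hom_mono[OF hom]) simp
    ultimately show ?thesis using hz hk by (simp add: bot_unique)
  qed
  ultimately have "ba_atom (h x)" by (simp add: ba_atom_def)
  moreover have "h x \<le> a"
    using complete_boolean_hom_mono[OF hom] x(2) b by (metis le_inf_iff)
  ultimately show "\<exists>x. ba_atom x \<and> x \<le> a" by blast
qed

theorem theorem3p24:
  fixes boxM :: "'a::{boolean_algebra, complete_lattice} \<Rightarrow> 'a"
  assumes "mt_algebra boxM"
    and "\<not> mt_spatial boxM"
  shows "\<not> (\<exists>(boxN :: 'b::{boolean_algebra, complete_lattice} \<Rightarrow> 'b) (h :: 'b \<Rightarrow> 'a).
             mt_T1_compactification boxM boxN h)"
proof clarify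
  fix boxN :: "'b \<Rightarrow> 'b" and h :: "'b \<Rightarrow> 'a"
  assume "mt_T1_compactification boxM boxN h"
  then have "mt_algebra boxN" "mt_compact boxN" "mt_T1 boxN"
    and h: "complete_boolean_hom h" "surj h"
    by (auto simp: mt_T1_compactification_def mt_compactification_def mt_embedding_def
        mt_morphism_def)
  then have "mt_spatial boxN"
    by (intro mt_algebra.mt_compact_T1_imp_spatial)
  then show False
    using mt_spatial_image[OF h] assms(2) by blast
qed

end
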